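(* Suppose that $A,B\subseteq\mathbb{N}$ satisfy $\operatorname{\ell BD}(A)>0$ and $\operatorname{\ell BD}(B)>0$. Then there exists $m\in\mathbb{N}$ such that for all $n\in\mathbb{N}$ there is $x\in\mathbb{N}$ such that for every interval $[u,mu]\subseteq[x,nx]$ we have $[u,mu]\cap(A\cdot B)\neq\emptyset$.
   Context: $\mathbb{N}=\{1,2,3,\dots\}$; $A\cdot B=\{ab: a\in A, b\in B\}$. For $A\subseteq\mathbb{N}$, the (upper) Banach log density is $\operatorname{\ell BD}(A)=\lim_{n\to\infty}\sup_{k\ge1}\frac{1}{\ln n}\sum_{x\in A\cap[k,nk]}\frac1x$ (this limit exists). *)

theory Defs
  imports Complex_Main "HOL-Library.Set_Algebras"
begin

definition lBD :: "nat set \<Rightarrow> real" where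
  "lBD A = lim (\<lambda>n::nat. SUP k\<in>{1::nat..}.
      1 / ln (real n) * (\<Sum>x\<in>A \<inter> {k..n * k}. 1 / real x))"

end

theory Submission
  imports Defs "HOL-Library.Discrete_Functions" "HOL-Library.Disjoint_Sets"
begin

text \<open>
  Replacing every element by the integer part of its binary logarithm turns products into sums, up
  to an error of 1, and positive Banach log density into positive upper Banach density. It thus
  suffices to show Jin's theorem that the sumset of two sets \<open>X\<close>, \<open>Y\<close> of integers of
  positive upper Banach density is piecewise syndetic.

  By pigeonhole, some \<open>s\<close> makes \<open>C = X \<inter> (s - Y)\<close> large, and \<open>s + (C - C) \<subseteq> X + Y\<close>.
  A maximal family \<open>T\<close> of shifts \<open>t\<close> in \<open>[0, N)\<close> with \<open>t + C\<close> pairwise disjoint has a size bounded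
  in terms of the two densities only, and by maximality the translates of \<open>X + Y\<close> by \<open>T\<close> cover
  \<open>[s, s + N)\<close>. If \<open>X + Y\<close> were not piecewise syndetic, then nesting gaps would show that
  boundedly many translates of it cannot cover a sufficiently long interval.
\<close>

section \<open>Popular sums and covering by translates\<close>

lemma popular_sum:
  fixes X Y :: "'a::ab_group_add set"
  assumes fin: "finite X" "finite Y" and nonempty: "X \<noteq> {}" "Y \<noteq> {}"
  obtains s where "card X * card Y \<le> card (X + Y) * card {x \<in> X. s - x \<in> Y}"
proof -
  define r where "r s = card {x \<in> X. s - x \<in> Y}" for s
  have finite_sums: "finite (X + Y)"
    using fin by (rule finite_set_plus)
  have "X + Y \<noteq> {}"
    using nonempty by (auto simp: set_plus_def)
  with finite_sums have "Max (r ` (X + Y)) \<in> r ` (X + Y)"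
    by (intro Max_in) auto
  then obtain s where "r s = Max (r ` (X + Y))"
    by auto
  then have max: "r s' \<le> r s" if "s' \<in> X + Y" for s'
    using that finite_sums by simp
  have "card {s \<in> X + Y. s - x \<in> Y} = card Y" if "x \<in> X" for x
  proof -
    have "{s \<in> X + Y. s - x \<in> Y} = (+) x ` Y"
      using that by (force simp: image_iff)
    then show ?thesis
      by (simp add: card_image)
  qed
  then have "card X * card Y = (\<Sum>s'\<in>X + Y. r s')"
    unfolding r_def using finite_sums fin by (subst sum_multicount) (auto simp: mult.commute)
  also have "\<dots> \<le> card (X + Y) * r s"
    using sum_bounded_above[of "X + Y" r "r s"] max by simp
  finally show thesis
    using that by (simp add: r_def)
qed

lemma maximal_disjoint_subfamily:
  assumes "finite U"
  obtains T where "T \<subseteq> U" "disjoint_family_on F T" "\<And>u. u \<in> U - T \<Longrightarrow> \<exists>t\<in>T. F u \<inter> F t \<noteq> {}"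
proof -
  define packing where "packing T \<longleftrightarrow> T \<subseteq> U \<and> disjoint_family_on F T" for T
  have "{T. packing T} \<subseteq> Pow U"
    by (auto simp: packing_def)
  then have "finite {T. packing T}"
    using assms by (simp add: finite_subset)
  moreover have "packing {}"
    by (simp add: packing_def disjoint_family_on_def)
  ultimately obtain T where T: "packing T" and max: "\<And>T'. packing T' \<Longrightarrow> T \<subseteq> T' \<Longrightarrow> T = T'"
    using finite_has_maximal[of "{T. packing T}"] by blast
  have "\<exists>t\<in>T. F u \<inter> F t \<noteq> {}" if "u \<in> U - T" for u
  proof -
    have "\<not> packing (insert u T)"
      using max[of "insert u T"] that by blast
    with T that show ?thesis
      by (auto simp: packing_def disjoint_family_on_insert)
  qed
  with T show thesis
    using that by (auto simp: packing_def)
qed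

lemma Ruzsa_covering:
  fixes C U :: "'a::ab_group_add set"
  assumes fin: "finite C" "finite U" and "C \<noteq> {}"
  obtains T where "T \<subseteq> U" "card T * card C \<le> card (U + C)" "U \<subseteq> T + (C + uminus ` C)"
proof -
  obtain T where "T \<subseteq> U" and disjoint: "disjoint_family_on (\<lambda>t. (+) t ` C) T"
    and meets: "\<And>u. u \<in> U - T \<Longrightarrow> \<exists>t\<in>T. (+) u ` C \<inter> (+) t ` C \<noteq> {}"
    using maximal_disjoint_subfamily fin(2) by blast
  have "finite T"
    using \<open>T \<subseteq> U\<close> fin(2) by (rule finite_subset)
  then have "card T * card C = card (\<Union>t\<in>T. (+) t ` C)"
    using disjoint fin(1) by (simp add: card_UN_disjoint' card_image)
  also have "\<dots> \<le> card (U + C)"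
    using \<open>T \<subseteq> U\<close> fin by (intro card_mono finite_set_plus) auto
  finally have "card T * card C \<le> card (U + C)" .
  moreover have "u \<in> T + (C + uminus ` C)" if "u \<in> U" for u
  proof -
    have "\<exists>t\<in>T. (+) u ` C \<inter> (+) t ` C \<noteq> {}"
      using meets[of u] \<open>u \<in> U\<close> \<open>C \<noteq> {}\<close> by (cases "u \<in> T") auto
    then obtain t c d where "t \<in> T" "c \<in> C" "d \<in> C" "u + c = t + d"
      by auto
    then have "u = t + (d + - c)"
      by (simp add: algebra_simps)
    with \<open>t \<in> T\<close> \<open>c \<in> C\<close> \<open>d \<in> C\<close> show ?thesis
      by blast
  qed
  ultimately show thesis
    using that \<open>T \<subseteq> U\<close> by blast
qed

lemma translate_covered_by_translates_of_sumset:
  fixes X Y U :: "'a::ab_group_add set"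
  assumes fin: "finite X" "finite Y" "finite U" and nonempty: "X \<noteq> {}" "Y \<noteq> {}"
  obtains s T where "finite T" "card T * (card X * card Y) \<le> card (X + Y) * card (U + X)"
    "(+) s ` U \<subseteq> T + (X + Y)"
proof -
  obtain s where s: "card X * card Y \<le> card (X + Y) * card {x \<in> X. s - x \<in> Y}"
    using popular_sum fin(1,2) nonempty by blast
  define C where "C = {x \<in> X. s - x \<in> Y}"
  have "card X * card Y > 0"
    using fin nonempty by (simp add: card_gt_0_iff)
  with s have "card C > 0"
    unfolding C_def by (metis gr0I mult_0_right not_le)
  then have "C \<noteq> {}" "finite C"
    by (auto simp: card_gt_0_iff)
  then obtain T where T: "T \<subseteq> U" "card T * card C \<le> card (U + C)" "U \<subseteq> T + (C + uminus ` C)"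
    using Ruzsa_covering fin(3) by blast
  have "card T * (card X * card Y) \<le> card (X + Y) * (card T * card C)"
    using mult_le_mono2[OF s, of "card T"] by (simp add: C_def mult_ac)
  also have "\<dots> \<le> card (X + Y) * card (U + X)"
  proof (rule mult_le_mono2)
    have "card (U + C) \<le> card (U + X)"
      using fin by (intro card_mono finite_set_plus set_plus_mono2) (auto simp: C_def)
    with T(2) show "card T * card C \<le> card (U + X)"
      by simp
  qed
  finally have "card T * (card X * card Y) \<le> card (X + Y) * card (U + X)" .
  moreover have "s + u \<in> T + (X + Y)" if "u \<in> U" for u
  proof -
    obtain t c d where tcd: "t \<in> T" "c \<in> C" "d \<in> C" "u = t + (c + - d)"
      using T(3) \<open>u \<in> U\<close> by (blast elim: set_plus_elim)
    then have "s + u = t + (c + (s - d))"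
      by (simp add: algebra_simps)
    also have "\<dots> \<in> T + (X + Y)"
      using tcd by (intro set_plus_intro) (auto simp: C_def)
    finally show ?thesis .
  qed
  ultimately show thesis
    using that T(1) fin(3) by (meson finite_subset image_subsetI)
qed

section \<open>Sumsets of sets of positive upper Banach density\<close>

definition positive_upper_Banach_density :: "int set \<Rightarrow> bool" where
  "positive_upper_Banach_density X \<longleftrightarrow>
    (\<exists>a>0. \<forall>N::nat. \<exists>L\<ge>N. \<exists>p. a * real L \<le> card (X \<inter> {p..<p + int L}))"

definition piecewise_syndetic :: "int set \<Rightarrow> bool" where
  "piecewise_syndetic S \<longleftrightarrow> (\<exists>m::nat. \<forall>n::nat. \<exists>x. \<forall>y.
    {y..<y + int m} \<subseteq> {x..<x + int n} \<longrightarrow> {y..<y + int m} \<inter> S \<noteq> {})"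

lemma card_sumset_of_windows_le:
  assumes "X \<subseteq> {p..<p + int L}" "Y \<subseteq> {q..<q + int M}"
  shows "card (X + Y) \<le> L + M"
proof -
  have "X + Y \<subseteq> {p..<p + int L} + {q..<q + int M}"
    using assms by (rule set_plus_mono2)
  also have "\<dots> \<subseteq> {p + q..<p + q + int (L + M)}"
    by (auto elim!: set_plus_elim)
  finally have "card (X + Y) \<le> card {p + q..<p + q + int (L + M)}"
    by (rule card_mono[rotated]) simp
  then show ?thesis
    by (simp add: nat_add_distrib)
qed

lemma interval_covered_by_translates_of_sumset:
  assumes X: "X \<subseteq> {p..<p + int L}" "a * real L \<le> card X"
    and Y: "Y \<subseteq> {q..<q + int M}" "b * real M \<le> card Y"
    and pos: "a > 0" "b > 0" "L > 0" and le: "N \<le> L" "L \<le> M"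
  obtains s T where "finite T" "real (card T) \<le> 4 / (a * b)" "{s..<s + int N} \<subseteq> T + (X + Y)"
proof -
  have "a * real L > 0" "b * real M > 0"
    using pos le by auto
  then have "card X > 0" "card Y > 0"
    using X(2) Y(2) by linarith+
  then have "finite X" "finite Y" "X \<noteq> {}" "Y \<noteq> {}"
    by (auto simp: card_gt_0_iff)
  then obtain s T where T: "finite T" "(+) s ` {0..<int N} \<subseteq> T + (X + Y)"
    and card: "card T * (card X * card Y) \<le> card (X + Y) * card ({0..<int N} + X)"
    by (rule translate_covered_by_translates_of_sumset[OF _ _ finite_atLeastLessThan_int])
  have "card (X + Y) \<le> 2 * M" "card ({0..<int N} + X) \<le> 2 * L"
    using card_sumset_of_windows_le[OF X(1) Y(1)]
      card_sumset_of_windows_le[of "{0..<int N}" 0 N, OF _ X(1)] le by auto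
  then have "card (X + Y) * card ({0..<int N} + X) \<le> (2 * M) * (2 * L)"
    by (rule mult_le_mono)
  then have "card T * (card X * card Y) \<le> 4 * (M * L)"
    using card by simp
  then have "real (card T) * (real (card X) * real (card Y)) \<le> 4 * (real M * real L)"
    unfolding of_nat_mult[symmetric] by linarith
  moreover have "real (card T) * ((a * real L) * (b * real M)) \<le>
      real (card T) * (real (card X) * real (card Y))"
    using X(2) Y(2) pos by (intro mult_left_mono mult_mono) auto
  ultimately have "real (card T) * (a * b) * (real L * real M) \<le> 4 * (real L * real M)"
    by (simp add: mult_ac)
  then have "real (card T) * (a * b) \<le> 4"
    using pos le by simp
  then have "real (card T) \<le> 4 / (a * b)"
    using pos by (simp add: field_simps)
  moreover have "{s..<s + int N} \<subseteq> T + (X + Y)"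
    using T(2) by (simp add: image_add_atLeastLessThan add.commute)
  ultimately show thesis
    using that T(1) by blast
qed

lemma few_translates_do_not_cover_interval:
  assumes "\<not> piecewise_syndetic S"
  shows "\<exists>N::nat. \<forall>T x. finite T \<and> card T \<le> K \<longrightarrow> \<not> {x..<x + int N} \<subseteq> T + S"
proof (induction K)
  case 0
  have "\<not> {x..<x + int 1} \<subseteq> {} + S" for x
    by simp
  then show ?case
    by (metis card_0_eq le_zero_eq)
next
  case (Suc K)
  then obtain N :: nat
    where N: "\<And>T x. finite T \<Longrightarrow> card T \<le> K \<Longrightarrow> \<not> {x..<x + int N} \<subseteq> T + S"
    by blast
  obtain n :: nat where gap:
    "\<And>x. \<exists>y. {y..<y + int N} \<subseteq> {x..<x + int n} \<and> {y..<y + int N} \<inter> S = {}"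
    using assms unfolding piecewise_syndetic_def by meson
  have "\<not> {x..<x + int n} \<subseteq> T + S" if T: "finite T" "card T \<le> Suc K" for T x
  proof -
    obtain t where "T = {} \<or> t \<in> T"
      by blast
    then have "card (T - {t}) \<le> K"
      using T by auto
    obtain y where y: "{y..<y + int N} \<subseteq> {x - t..<x - t + int n}" "{y..<y + int N} \<inter> S = {}"
      using gap by blast
    obtain z where z: "z \<in> {y + t..<y + t + int N}" "z \<notin> (T - {t}) + S"
      using N[of "T - {t}" "y + t"] T(1) \<open>card (T - {t}) \<le> K\<close> by blast
    have "z - t \<in> {y..<y + int N}"
      using z(1) by auto
    then have "z - t \<notin> S" "z - t \<in> {x - t..<x - t + int n}"
      using y by blast+
    moreover from this have "z \<notin> T + S"
      using z(2) by (force elim: set_plus_elim)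
    ultimately show ?thesis
      by auto
  qed
  then show ?case
    by blast
qed

theorem sumset_piecewise_syndetic:
  assumes "positive_upper_Banach_density X" "positive_upper_Banach_density Y"
  shows "piecewise_syndetic (X + Y)"
proof (rule ccontr)
  obtain a where "a > 0" and dense_X: "\<And>N. \<exists>L\<ge>N. \<exists>p. a * real L \<le> card (X \<inter> {p..<p + int L})"
    using assms(1) unfolding positive_upper_Banach_density_def by blast
  obtain b where "b > 0" and dense_Y: "\<And>N. \<exists>M\<ge>N. \<exists>q. b * real M \<le> card (Y \<inter> {q..<q + int M})"
    using assms(2) unfolding positive_upper_Banach_density_def by blast
  assume "\<not> piecewise_syndetic (X + Y)"
  from few_translates_do_not_cover_interval[OF this, of "nat \<lfloor>4 / (a * b)\<rfloor>"]
  obtain N where N: "\<And>T x. finite T \<Longrightarrow> card T \<le> nat \<lfloor>4 / (a * b)\<rfloor> \<Longrightarrow>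
      \<not> {x..<x + int N} \<subseteq> T + (X + Y)"
    by blast
  obtain L p where L: "L \<ge> Suc N" "a * real L \<le> card (X \<inter> {p..<p + int L})"
    using dense_X by blast
  obtain M q where M: "M \<ge> L" "b * real M \<le> card (Y \<inter> {q..<q + int M})"
    using dense_Y by blast
  have "L > 0" "N \<le> L"
    using L(1) by auto
  then obtain s T where T: "finite T" "real (card T) \<le> 4 / (a * b)"
    "{s..<s + int N} \<subseteq> T + (X \<inter> {p..<p + int L} + Y \<inter> {q..<q + int M})"
    by (rule interval_covered_by_translates_of_sumset[OF Int_lower2 L(2) Int_lower2 M(2)
          \<open>a > 0\<close> \<open>b > 0\<close> _ _ M(1)])
  have "{s..<s + int N} \<subseteq> T + (X + Y)"
    using T(3) by (rule order_trans) (intro set_plus_mono2 Int_lower1 order_refl)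
  moreover have "card T \<le> nat \<lfloor>4 / (a * b)\<rfloor>"
    using T(2) by (rule le_nat_floor)
  ultimately show False
    using N T(1) by blast
qed

section \<open>Binary logarithms\<close>

lemma floor_log_less_imp_less: "floor_log m < floor_log n \<Longrightarrow> m < n"
  using floor_log_mono by (rule mono_strict_invE)

lemma floor_log_add_le_mult:
  assumes "a > 0" "b > 0"
  shows "floor_log a + floor_log b \<le> floor_log (a * b)"
proof -
  have "2 ^ (floor_log a + floor_log b) \<le> a * b"
    unfolding power_add using assms by (intro mult_le_mono floor_log_exp2_le)
  then show ?thesis
    using floor_log_le_iff by fastforce
qed

lemma floor_log_mult_le:
  assumes "a > 0" "b > 0"
  shows "floor_log (a * b) \<le> floor_log a + floor_log b + 1"
proof -
  have "2 ^ floor_log (a * b) \<le> a * b"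
    using assms by (intro floor_log_exp2_le) simp
  also have "\<dots> < (2 * 2 ^ floor_log a) * (2 * 2 ^ floor_log b)"
    using assms by (intro mult_strict_mono floor_log_exp2_gt) auto
  also have "\<dots> = 2 ^ (floor_log a + floor_log b + 2)"
    by (simp add: power_add)
  finally show ?thesis
    by (simp del: add_2_eq_Suc')
qed

lemma floor_log_mult_ln2_le_ln:
  assumes "n > 0"
  shows "real (floor_log n) * ln 2 \<le> ln (real n)"
proof -
  have "2 ^ floor_log n \<le> real n"
    using floor_log_exp2_le[OF assms] by simp
  then have "ln (2 ^ floor_log n) \<le> ln (real n)"
    by (rule ln_mono) simp
  then show ?thesis
    by (simp add: ln_realpow)
qed

lemma sum_inverse_same_floor_log_le:
  assumes "finite Z" "0 \<notin> Z" "\<And>x. x \<in> Z \<Longrightarrow> floor_log x = i"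
  shows "(\<Sum>x\<in>Z. 1 / real x) \<le> 1"
proof -
  have block: "2 ^ i \<le> x \<and> x < 2 * 2 ^ i" if "x \<in> Z" for x
    using that assms floor_log_exp2_le[of x] floor_log_exp2_gt[of x] by (metis gr0I)
  then have "Z \<subseteq> {2 ^ i..<2 * 2 ^ i}"
    by auto
  then have "card Z \<le> card {2 ^ i..<2 * 2 ^ i :: nat}"
    by (intro card_mono) simp
  then have "card Z \<le> 2 ^ i"
    by simp
  have "(\<Sum>x\<in>Z. 1 / real x) \<le> real (card Z) * (1 / 2 ^ i)"
  proof (rule sum_bounded_above)
    fix x assume "x \<in> Z"
    then have "2 ^ i \<le> real x"
      using block by simp
    then show "1 / real x \<le> 1 / 2 ^ i"
      by (intro frac_le) auto
  qed
  also have "\<dots> \<le> 1"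
    using \<open>card Z \<le> 2 ^ i\<close> by simp
  finally show ?thesis .
qed

lemma sum_inverse_le_card_floor_log:
  assumes "finite Z" "0 \<notin> Z"
  shows "(\<Sum>x\<in>Z. 1 / real x) \<le> card (floor_log ` Z)"
proof -
  have "(\<Sum>x\<in>Z. 1 / real x) = (\<Sum>i\<in>floor_log ` Z. \<Sum>x | x \<in> Z \<and> floor_log x = i. 1 / real x)"
    using assms(1) by (rule sum.image_gen)
  also have "\<dots> \<le> of_nat (card (floor_log ` Z)) * 1"
    using assms by (intro sum_bounded_above sum_inverse_same_floor_log_le) auto
  finally show ?thesis
    by simp
qed

section \<open>Passing from products to sums\<close>

definition log_scale :: "nat set \<Rightarrow> int set" where
  "log_scale A = (\<lambda>x. int (floor_log x)) ` A"

lemma sum_inverse_le_card_log_scale: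
  assumes "0 \<notin> A" "n > 0" "k > 0"
  shows "(\<Sum>x\<in>A \<inter> {k..n * k}. 1 / real x) \<le>
    card (log_scale A \<inter> {int (floor_log k)..<int (floor_log k) + int (floor_log n + 2)})"
    (is "_ \<le> real (card (_ \<inter> ?W))")
proof -
  let ?Z = "A \<inter> {k..n * k}"
  have "int (floor_log x) \<in> ?W" if "k \<le> x" "x \<le> n * k" for x
    using floor_log_le_iff[OF that(1)] floor_log_le_iff[OF that(2)]
      floor_log_mult_le[OF assms(2,3)] by simp
  then have "int ` floor_log ` ?Z \<subseteq> log_scale A \<inter> ?W"
    by (auto simp: log_scale_def)
  then have "card (int ` floor_log ` ?Z) \<le> card (log_scale A \<inter> ?W)"
    by (intro card_mono) auto
  moreover have "(\<Sum>x\<in>?Z. 1 / real x) \<le> card (floor_log ` ?Z)"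
    using assms(1) by (intro sum_inverse_le_card_floor_log) auto
  ultimately show ?thesis
    by (simp add: card_image)
qed

text \<open>
  \<open>lim\<close> is a junk value on a divergent sequence, but a nonnegative sequence with no subsequence
  bounded away from 0 does converge, to 0.
\<close>
lemma lim_SUP_pos_imp_frequently_ge:
  fixes g :: "nat \<Rightarrow> 'a \<Rightarrow> real"
  assumes nonneg: "\<And>n k. k \<in> K \<Longrightarrow> 0 \<le> g n k" and "K \<noteq> {}"
    and pos: "lim (\<lambda>n. SUP k\<in>K. g n k) > 0"
  shows "\<exists>e>0. \<exists>\<^sub>F n in sequentially. \<exists>k\<in>K. e \<le> g n k"
proof (rule ccontr)
  assume "\<not> ?thesis"
  then have small: "\<forall>\<^sub>F n in sequentially. \<forall>k\<in>K. g n k < e" if "e > 0" for e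
    using that by (simp add: not_frequently not_le)
  have "(\<lambda>n. SUP k\<in>K. g n k) \<longlonglongrightarrow> 0"
  proof (rule tendstoI)
    fix r :: real assume "r > 0"
    then have "\<forall>\<^sub>F n in sequentially. \<forall>k\<in>K. g n k < r / 2"
      by (intro small) simp
    then show "\<forall>\<^sub>F n in sequentially. dist (SUP k\<in>K. g n k) 0 < r"
    proof eventually_elim
      case (elim n)
      then have "(SUP k\<in>K. g n k) \<le> r / 2"
        using \<open>K \<noteq> {}\<close> by (intro cSUP_least) (auto intro: less_imp_le)
      moreover have "0 \<le> (SUP k\<in>K. g n k)"
      proof -
        obtain k where "k \<in> K"
          using \<open>K \<noteq> {}\<close> by blast
        with elim nonneg show ?thesis
          by (intro cSUP_upper2 bdd_aboveI2[of _ _ "r / 2"]) (auto intro: less_imp_le)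
      qed
      ultimately show ?case
        using \<open>r > 0\<close> by simp
    qed
  qed
  then show False
    using pos by (simp add: limI)
qed

lemma lBD_pos_imp_frequently_ge:
  assumes "lBD A > 0"
  shows "\<exists>e>0. \<exists>\<^sub>F n in sequentially. \<exists>k\<ge>1. e * ln (real n) \<le> (\<Sum>x\<in>A \<inter> {k..n * k}. 1 / real x)"
proof -
  define g where "g n k = 1 / ln (real n) * (\<Sum>x\<in>A \<inter> {k..n * k}. 1 / real x)" for n k :: nat
  have ln_nonneg: "0 \<le> ln (real n)" for n
    by (cases "n = 0") auto
  then have "0 \<le> g n k" for n k
    by (auto simp: g_def intro!: divide_nonneg_nonneg sum_nonneg)
  then obtain e where "e > 0" and frequently: "\<exists>\<^sub>F n in sequentially. \<exists>k\<in>{1..}. e \<le> g n k"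
    using lim_SUP_pos_imp_frequently_ge[of "{1..}" g] assms unfolding lBD_def g_def by auto
  have "e * ln (real n) \<le> (\<Sum>x\<in>A \<inter> {k..n * k}. 1 / real x)" if "e \<le> g n k" for n k
  proof -
    have "ln (real n) > 0"
      using that \<open>e > 0\<close> ln_nonneg[of n] by (cases "ln (real n) = 0") (auto simp: g_def)
    with that show ?thesis
      by (simp add: g_def pos_le_divide_eq)
  qed
  then have "\<exists>\<^sub>F n in sequentially. \<exists>k\<ge>1. e * ln (real n) \<le> (\<Sum>x\<in>A \<inter> {k..n * k}. 1 / real x)"
    using frequently by (auto elim!: frequently_elim1)
  with \<open>e > 0\<close> show ?thesis
    by blast
qed

lemma lBD_pos_imp_positive_upper_Banach_density:
  assumes "0 \<notin> A" "lBD A > 0"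
  shows "positive_upper_Banach_density (log_scale A)"
proof -
  obtain e where "e > 0" and dense: "\<And>n\<^sub>0. \<exists>n\<ge>n\<^sub>0. \<exists>k\<ge>1.
      e * ln (real n) \<le> (\<Sum>x\<in>A \<inter> {k..n * k}. 1 / real x)"
    using lBD_pos_imp_frequently_ge[OF assms(2)] unfolding frequently_sequentially by blast
  have "\<exists>L\<ge>N. \<exists>p. e * ln 2 / 2 * real L \<le> card (log_scale A \<inter> {p..<p + int L})" for N
  proof -
    obtain n k where n: "n \<ge> 2 ^ (N + 2)" and "k \<ge> 1"
      and sum: "e * ln (real n) \<le> (\<Sum>x\<in>A \<inter> {k..n * k}. 1 / real x)"
      using dense by blast
    have "N + 2 \<le> floor_log n"
      using floor_log_le_iff[OF n] by (simp del: power_Suc add_2_eq_Suc')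
    have "n > 0"
      using n by (rule less_le_trans[rotated]) simp
    let ?p = "int (floor_log k)" and ?L = "floor_log n + 2"
    have "real ?L / 2 * ln 2 \<le> real (floor_log n) * ln 2"
      using \<open>N + 2 \<le> floor_log n\<close> by (intro mult_right_mono) auto
    also have "\<dots> \<le> ln (real n)"
      using \<open>n > 0\<close> by (rule floor_log_mult_ln2_le_ln)
    finally have "e * ln 2 / 2 * real ?L \<le> e * ln (real n)"
      using mult_left_mono[of _ _ e] \<open>e > 0\<close> by (simp add: mult_ac)
    also note sum
    also have "(\<Sum>x\<in>A \<inter> {k..n * k}. 1 / real x) \<le> card (log_scale A \<inter> {?p..<?p + int ?L})"
      using assms(1) \<open>n > 0\<close> \<open>k \<ge> 1\<close> by (intro sum_inverse_le_card_log_scale) auto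
    finally show ?thesis
      using \<open>N + 2 \<le> floor_log n\<close> by (meson add_leD1 le_add1 order_trans)
  qed
  moreover have "e * ln 2 / 2 > 0"
    using \<open>e > 0\<close> by simp
  ultimately show ?thesis
    unfolding positive_upper_Banach_density_def by blast
qed

lemma product_set_meets_interval:
  assumes "0 \<notin> A" "0 \<notin> B" "u > 0"
    and "{int (floor_log u) + 1..<int (floor_log u) + 1 + int m} \<inter> (log_scale A + log_scale B) \<noteq> {}"
  shows "{u..2 ^ (m + 2) * u} \<inter> (A * B) \<noteq> {}"
proof -
  obtain c d where cd: "c \<in> A" "d \<in> B"
    and lower: "floor_log u < floor_log c + floor_log d"
    and upper: "floor_log c + floor_log d \<le> floor_log u + m"
    using assms(4) by (fastforce simp: log_scale_def elim!: set_plus_elim)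
  have pos: "c > 0" "d > 0"
    using cd assms(1,2) by (auto intro: gr0I)
  have "floor_log u < floor_log (c * d)"
    using lower floor_log_add_le_mult[OF pos] by linarith
  then have "u < c * d"
    by (rule floor_log_less_imp_less)
  moreover have "floor_log (c * d) < floor_log (2 ^ (m + 2) * u)"
    using upper floor_log_mult_le[OF pos] floor_log_add_le_mult[of "2 ^ (m + 2)" u] \<open>u > 0\<close>
    by (simp only: floor_log_power) simp
  then have "c * d < 2 ^ (m + 2) * u"
    by (rule floor_log_less_imp_less)
  moreover have "c * d \<in> A * B"
    using cd by (rule set_times_intro)
  ultimately have "c * d \<in> {u..2 ^ (m + 2) * u} \<inter> (A * B)"
    by simp
  then show ?thesis
    by blast
qed

lemma floor_log_window_subset:
  assumes "u > 0" "n > 0" "{u..2 ^ (m + 2) * u} \<subseteq> {2 ^ h..n * 2 ^ h}"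
  shows "{int (floor_log u) + 1..<int (floor_log u) + 1 + int m} \<subseteq> {int h..<int h + int (floor_log n)}"
proof -
  have "2 ^ h \<le> u" "2 ^ (m + 2) * u \<le> n * 2 ^ h"
    using assms(3) by (auto simp: subset_iff)
  from this[THEN floor_log_le_iff]
  have "h \<le> floor_log u" "m + 2 + floor_log u \<le> floor_log n + h + 1"
    using floor_log_add_le_mult[of "2 ^ (m + 2)" u] floor_log_mult_le[of n "2 ^ h"] assms(1,2)
    by (simp_all only: floor_log_power) simp_all
  then show ?thesis
    by auto
qed

lemma product_set_meets_geometric_intervals:
  assumes zero: "0 \<notin> A" "0 \<notin> B" and syndetic: "piecewise_syndetic (log_scale A + log_scale B)"
  shows "\<exists>m\<ge>1. \<forall>n\<ge>1. \<exists>x\<ge>1. \<forall>u\<ge>1.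
    {u..m * u} \<subseteq> {x..n * x} \<longrightarrow> {u..m * u} \<inter> (A * B) \<noteq> {}"
proof -
  obtain m :: nat where m: "\<And>n::nat. \<exists>x. \<forall>y. {y..<y + int m} \<subseteq> {x..<x + int n} \<longrightarrow>
      {y..<y + int m} \<inter> (log_scale A + log_scale B) \<noteq> {}"
    using syndetic unfolding piecewise_syndetic_def by blast
  have "\<exists>x\<ge>1. \<forall>u\<ge>1. {u..2 ^ (m + 2) * u} \<subseteq> {x..n * x} \<longrightarrow> {u..2 ^ (m + 2) * u} \<inter> (A * B) \<noteq> {}"
    if "n \<ge> 1" for n
  proof -
    obtain x where x: "\<And>y. {y..<y + int m} \<subseteq> {x..<x + int (m + floor_log n)} \<Longrightarrow>
        {y..<y + int m} \<inter> (log_scale A + log_scale B) \<noteq> {}"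
      using m by blast
    \<comment> \<open>The left end \<open>x\<close> may be negative, but by less than the width of a window.\<close>
    have "{x..<x + int m} \<inter> (log_scale A + log_scale B) \<noteq> {}"
      by (rule x) simp
    then have "x + int m \<ge> 0"
      by (auto simp: log_scale_def elim!: set_plus_elim)
    then obtain h where h: "int h = x + int m"
      using nonneg_eq_int by metis
    have "{u..2 ^ (m + 2) * u} \<inter> (A * B) \<noteq> {}"
      if u: "u \<ge> 1" "{u..2 ^ (m + 2) * u} \<subseteq> {2 ^ h..n * 2 ^ h}" for u
    proof (rule product_set_meets_interval[OF zero _ x])
      show "u > 0" using u(1) by simp
      have "{int (floor_log u) + 1..<int (floor_log u) + 1 + int m} \<subseteq>
          {int h..<int h + int (floor_log n)}"
        using u \<open>n \<ge> 1\<close> by (intro floor_log_window_subset) auto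
      also have "\<dots> \<subseteq> {x..<x + int (m + floor_log n)}"
        using h by auto
      finally show "{int (floor_log u) + 1..<int (floor_log u) + 1 + int m} \<subseteq>
          {x..<x + int (m + floor_log n)}" .
    qed
    then show ?thesis
      by (intro exI[of _ "2 ^ h"]) auto
  qed
  then show ?thesis
    by (intro exI[of _ "2 ^ (m + 2)"]) auto
qed

theorem theorem6p8:
  fixes A B :: "nat set"
  assumes "A \<subseteq> {1..}" and "B \<subseteq> {1..}"
    and "lBD A > 0" and "lBD B > 0"
  shows "\<exists>m\<ge>1. \<forall>n\<ge>1. \<exists>x\<ge>1. \<forall>u\<ge>1.
    {u..m * u} \<subseteq> {x..n * x} \<longrightarrow> {u..m * u} \<inter> (A * B) \<noteq> {}"
proof -
  have zero: "0 \<notin> A" "0 \<notin> B"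
    using assms(1,2) by auto
  then have "positive_upper_Banach_density (log_scale A)" "positive_upper_Banach_density (log_scale B)"
    using assms(3,4) by (auto intro: lBD_pos_imp_positive_upper_Banach_density)
  then have "piecewise_syndetic (log_scale A + log_scale B)"
    by (rule sumset_piecewise_syndetic)
  with zero show ?thesis
    by (rule product_set_meets_geometric_intervals)
qed

end
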